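(* Let $k\geq 6$ and suppose $\mathcal A$ is a $4$-splitting family on $k$. Then $|\mathcal A|\geq\log_2 k$.
   Context: Let $[k]=\{1,\dots,k\}$. For $A,B\subseteq[k]$ with $|B|$ even, $A$ splits $B$ if $|A\cap B|=|B|/2$. A family $\mathcal A$ of subsets of $[k]$ is a $4$-splitting family on $k$ if every $B\subseteq[k]$ with $|B|=4$ is split by some $A\in\mathcal A$. *)

theory Defs
  imports Complex_Main
begin

definition splits :: "nat set \<Rightarrow> nat set \<Rightarrow> bool" where
  "splits A B \<longleftrightarrow> even (card B) \<and> card (A \<inter> B) = card B div 2"

definition splitting_family :: "nat \<Rightarrow> nat \<Rightarrow> nat set set \<Rightarrow> bool" where
  "splitting_family t k \<A> \<longleftrightarrow>
     (\<forall>A\<in>\<A>. A \<subseteq> {1..k}) \<and>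
     (\<forall>B. B \<subseteq> {1..k} \<and> card B = t \<longrightarrow> (\<exists>A\<in>\<A>. splits A B))"

end

theory Submission
  imports Defs
begin

text \<open>
  Record each point by its trace, the set of members of the family that contain it. There are
  at most \<^term>\<open>2 ^ card \<A>\<close> traces, so distinct traces would settle the claim; the work is to
  account for twins, that is, distinct points with the same trace.

  A member that splits a four-set containing twins \<open>x\<close>, \<open>y\<close> has the twins on one side and the
  other two points on the other side (\<open>separate_twins\<close>). Hence no three points share a trace
  (\<open>no_three_with_one_trace\<close>), and the trace of twins occurs in every pair of complementary
  traces (\<open>twins_meet_complementary_pairs\<close>): no member has two points with complementary
  traces on one side.

  Let \<open>V\<close> be the set of traces. If no two traces are complementary, then \<open>V\<close> and its set of
  complements are disjoint families of subsets of \<open>\<A>\<close>, so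
  \<open>k \<le> 2 * card V \<le> 2 ^ card \<A>\<close>. Otherwise fix complementary traces \<open>v\<close> and \<open>w\<close>. Twins have
  trace \<open>v\<close> or \<open>w\<close>, so \<open>k \<le> card V + 2\<close>. If a second complementary pair exists, there are
  no twins at all. If it does not, \<open>V\<close> and its complements overlap only in \<open>v\<close> and \<open>w\<close>, so
  they form at least \<open>2 * card V - 2\<close> subsets of \<open>\<A>\<close>, and this is at least \<open>card V + 2\<close> because
  \<open>k \<ge> 6\<close> forces \<open>card V \<ge> 4\<close>.
\<close>

definition trace :: "'a set set \<Rightarrow> 'a \<Rightarrow> 'a set set" where
  "trace \<A> x = {A \<in> \<A>. x \<in> A}"

lemma trace_subset: "trace \<A> x \<subseteq> \<A>"
  by (auto simp: trace_def)

lemma trace_eqD: "trace \<A> x = trace \<A> y \<Longrightarrow> A \<in> \<A> \<Longrightarrow> x \<in> A \<longleftrightarrow> y \<in> A"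
  by (auto simp: trace_def set_eq_iff)

lemma trace_complD: "trace \<A> y = \<A> - trace \<A> x \<Longrightarrow> A \<in> \<A> \<Longrightarrow> x \<in> A \<longleftrightarrow> y \<notin> A"
  by (auto simp: trace_def set_eq_iff)

text \<open>The twins contribute 0 or 2 to the intersection with the splitting member, so the other
  two points together contribute 2 or 0.\<close>

lemma separate_twins:
  assumes "splitting_family 4 k \<A>"
    and "{x, y, p, q} \<subseteq> {1..k}" and "distinct [x, y, p, q]"
    and "trace \<A> x = trace \<A> y"
  obtains A where "A \<in> \<A>" "x \<in> A \<longleftrightarrow> p \<notin> A" "x \<in> A \<longleftrightarrow> q \<notin> A"
proof -
  have "card {x, y, p, q} = 4"
    using assms(3) by auto
  then obtain A where A: "A \<in> \<A>" "splits A {x, y, p, q}"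
    using assms(1,2) unfolding splitting_family_def by blast
  then have "card (A \<inter> {x, y, p, q}) = 2"
    using \<open>card {x, y, p, q} = 4\<close> by (simp add: splits_def)
  moreover have "x \<in> A \<longleftrightarrow> y \<in> A"
    using trace_eqD[OF assms(4) A(1)] .
  ultimately have "(x \<in> A \<longleftrightarrow> p \<notin> A) \<and> (x \<in> A \<longleftrightarrow> q \<notin> A)"
    using assms(3) by (auto simp: Int_insert_right split: if_splits)
  then show thesis
    using that A(1) by blast
qed

text \<open>A fourth point, whatever its trace, makes a four-set that no member splits.\<close>

lemma no_three_with_one_trace:
  assumes "splitting_family 4 k \<A>" and "4 \<le> k"
    and "{x, y, z} \<subseteq> {1..k}" and "distinct [x, y, z]"
    and "trace \<A> x = trace \<A> y" and "trace \<A> z = trace \<A> x"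
  shows False
proof -
  have "card {x, y, z} < card {1..k}"
    using assms(2,4) by simp
  then obtain q where "q \<in> {1..k}" "q \<notin> {x, y, z}"
    by (metis card_mono finite.emptyI finite.insertI linorder_not_less subsetI)
  then obtain A where "A \<in> \<A>" "x \<in> A \<longleftrightarrow> z \<notin> A"
    using separate_twins[OF assms(1), of x y z q] assms(3-5) by auto
  then show False
    using trace_eqD[OF assms(6)] by blast
qed

text \<open>A member separates two points with complementary traces, so it cannot have both of them
  opposite to the twins.\<close>

lemma twins_meet_complementary_pairs:
  assumes "splitting_family 4 k \<A>"
    and "{x, y, p, q} \<subseteq> {1..k}" and "x \<noteq> y" and "trace \<A> x = trace \<A> y"
    and "trace \<A> q = \<A> - trace \<A> p"
  shows "trace \<A> x \<in> {trace \<A> p, trace \<A> q}"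
proof (rule ccontr)
  assume other: "trace \<A> x \<notin> {trace \<A> p, trace \<A> q}"
  \<comment> \<open>A trace can equal its own complement only in the empty family, where all traces agree.\<close>
  have "p \<noteq> q"
    using other assms(5) trace_subset[of \<A> x] by auto
  then have "distinct [x, y, p, q]"
    using other assms(3,4) by auto
  then obtain A where "A \<in> \<A>" "x \<in> A \<longleftrightarrow> p \<notin> A" "x \<in> A \<longleftrightarrow> q \<notin> A"
    using separate_twins[OF assms(1,2) _ assms(4)] by metis
  then show False
    using trace_complD[OF assms(5)] by blast
qed

lemma card_eq_sum_fibres:
  assumes "finite S"
  shows "card S = (\<Sum>v\<in>f ` S. card {x \<in> S. f x = v})"
  using sum.image_gen[OF assms, of "\<lambda>_. 1 :: nat" f] by simp

lemma card_Un_complements: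
  assumes "finite U" and "V \<subseteq> Pow U"
  shows "2 * card V \<le> 2 ^ card U + card (V \<inter> (\<lambda>v. U - v) ` V)"
proof -
  let ?C = "(\<lambda>v. U - v) ` V"
  have fin: "finite V"
    using assms finite_subset by blast
  have "inj_on (\<lambda>v. U - v) V"
    using assms(2) by (intro inj_onI) blast
  then have "2 * card V = card V + card ?C"
    by (simp add: card_image)
  also have "\<dots> = card (V \<union> ?C) + card (V \<inter> ?C)"
    using fin by (intro card_Un_Int) auto
  also have "card (V \<union> ?C) \<le> card (Pow U)"
    using assms by (intro card_mono) auto
  finally show ?thesis
    using assms(1) by (simp add: card_Pow)
qed

lemma splitting_family_finite:
  assumes "splitting_family t k \<A>"
  shows "finite \<A>"
proof (rule finite_subset)
  show "\<A> \<subseteq> Pow {1..k}"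
    using assms by (auto simp: splitting_family_def)
qed simp

lemma four_splitting_family_size:
  assumes "splitting_family 4 k \<A>" and "6 \<le> k"
  shows "k \<le> 2 ^ card \<A>"
proof -
  define V where "V = trace \<A> ` {1..k}"
  define fibre where "fibre v = {x \<in> {1..k}. trace \<A> x = v}" for v
  have fin: "finite \<A>"
    by (rule splitting_family_finite[OF assms(1)])
  have V_sub: "V \<subseteq> Pow \<A>"
    by (auto simp: V_def trace_def)
  have fin_V: "finite V"
    by (simp add: V_def)
  have sum_fibres: "(\<Sum>v\<in>V. card (fibre v)) = k"
    unfolding V_def fibre_def by (subst card_eq_sum_fibres[symmetric]) simp_all
  have fibre_le: "card (fibre v) \<le> 2" for v
  proof (rule ccontr)
    assume "\<not> card (fibre v) \<le> 2"
    then obtain T where "T \<subseteq> fibre v" "card T = 3"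
      using obtain_subset_with_card_n[of 3 "fibre v"] by auto
    then obtain x y z where "{x, y, z} \<subseteq> fibre v" "distinct [x, y, z]"
      by (auto simp: card_3_iff)
    then show False
      using no_three_with_one_trace[OF assms(1), of x y z] assms(2) by (auto simp: fibre_def)
  qed
  show ?thesis
  proof (cases "V \<inter> (\<lambda>v. \<A> - v) ` V = {}")
    case True
    have "k \<le> 2 * card V"
      using sum_bounded_above[of V "\<lambda>v. card (fibre v)" 2] fibre_le by (simp add: sum_fibres)
    then show ?thesis
      using card_Un_complements[OF fin V_sub] True by simp
  next
    case False
    then obtain v w where vw: "v \<in> V" "w \<in> V" "w = \<A> - v"
      by blast
    have small: "card (fibre u) \<le> 1" if "a \<in> V" "\<A> - a \<in> V" "u \<notin> {a, \<A> - a}" for u a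
    proof (rule ccontr)
      assume "\<not> card (fibre u) \<le> 1"
      then obtain T where "T \<subseteq> fibre u" "card T = 2"
        using obtain_subset_with_card_n[of 2 "fibre u"] by auto
      then obtain x y where "x \<in> fibre u" "y \<in> fibre u" "x \<noteq> y"
        by (auto simp: card_2_iff)
      moreover obtain p q where "p \<in> {1..k}" "trace \<A> p = a" "q \<in> {1..k}" "trace \<A> q = \<A> - a"
        using \<open>a \<in> V\<close> \<open>\<A> - a \<in> V\<close> unfolding V_def by blast
      ultimately show False
        using twins_meet_complementary_pairs[OF assms(1), of x y p q] that(3)
        by (auto simp: fibre_def)
    qed
    have "k \<le> (\<Sum>u\<in>V. 1 + (if u \<in> {v, w} then 1 else 0))"
      unfolding sum_fibres[symmetric]
    proof (rule sum_mono)
      fix u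
      show "card (fibre u) \<le> 1 + (if u \<in> {v, w} then 1 else 0)"
        using fibre_le[of u] small[of v u] vw by (cases "u \<in> {v, w}") auto
    qed
    also have "\<dots> = card V + card (V \<inter> {v, w})"
      unfolding sum.distrib card_eq_sum sum.inter_restrict[OF fin_V] ..
    also have "card (V \<inter> {v, w}) \<le> 2"
      using card_mono[of "{v, w}" "V \<inter> {v, w}"] card_insert_le_m1[of 2 "{w}" v] by simp
    finally have k_le: "k \<le> card V + 2"
      by simp
    show ?thesis
    proof (cases "V \<inter> (\<lambda>v. \<A> - v) ` V \<subseteq> {v, w}")
      case True
      then have "card (V \<inter> (\<lambda>v. \<A> - v) ` V) \<le> card {v, w}"
        by (intro card_mono) auto
      then have "2 * card V \<le> 2 ^ card \<A> + 2"
        using card_Un_complements[OF fin V_sub] card_insert_le_m1[of 2 "{w}" v] by simp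
      then show ?thesis
        using k_le assms(2) by linarith
    next
      case False
      then obtain a b where "a \<in> V" "b \<in> V" "b = \<A> - a" "b \<notin> {v, w}"
        by blast
      moreover have compl_compl: "\<A> - (\<A> - u) = u" if "u \<in> V" for u
        using V_sub that by blast
      ultimately have b: "b \<in> V" "\<A> - b \<in> V" "b \<notin> {v, w}"
        by auto
      then have "\<A> - b \<notin> {v, w}"
        using vw compl_compl by auto
      then have "{b, \<A> - b} \<inter> {v, w} = {}"
        using b(3) by auto
      \<comment> \<open>A trace cannot lie in both of these disjoint complementary pairs.\<close>
      then have "card (fibre u) \<le> 1" for u
        using small[of v u] small[of b u] b(1,2) vw by blast
      then have "k \<le> card V"
        using sum_bounded_above[of V "\<lambda>v. card (fibre v)" 1] by (simp add: sum_fibres)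
      also have "\<dots> \<le> card (Pow \<A>)"
        using fin V_sub by (intro card_mono) auto
      finally show ?thesis
        using fin by (simp add: card_Pow)
    qed
  qed
qed

theorem theorem3p1:
  fixes k :: nat and \<A> :: "nat set set"
  assumes "k \<ge> 6"
    and "splitting_family 4 k \<A>"
  shows "real (card \<A>) \<ge> log 2 (real k)"
proof -
  have "k \<le> 2 ^ card \<A>"
    by (rule four_splitting_family_size[OF assms(2,1)])
  then show ?thesis
    using assms(1) by (simp add: log2_of_power_le)
qed

end
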